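(* Suppose $\Gamma\in\mathbb{R}^{r\times r}$ satisfies $\mu_\infty(\Gamma)<0$. Then the following statements hold: (a) If $\mu_1(\Gamma)<0$, then $\mu_p(\Gamma)<0$ for all $p\in(1,\infty)$. (b) If $\mu_1(\Gamma)\ge0$, then $\mu_p(\Gamma)<0$ for all $p\in(\underline{p},\infty)$, where $$\underline{p}:=1+\max_{i\in\{1,\dots,r\}}\frac{[\mathcal{M}(\Gamma)^\top\mathbf{1}]_i}{-[\mathcal{M}(\Gamma)\mathbf{1}]_i}\ge1.$$
   Context: For $M\in\mathbb{R}^{r\times r}$ and $p\in[1,\infty]$, the matrix measure (logarithmic norm) is $\mu_p(M):=\lim_{h\to0^+}\frac{\|I+hM\|_p-1}{h}$, where $\|\cdot\|_p$ is the matrix norm induced by the vector $p$-norm. For $\Gamma\in\mathbb{R}^{r\times r}$, the matrix $\mathcal{M}(\Gamma)\in\mathbb{R}^{r\times r}$ is defined by $\mathcal{M}(\Gamma)_{i,k}=\Gamma_{i,k}$ if $i=k$ and $\mathcal{M}(\Gamma)_{i,k}=|\Gamma_{i,k}|$ otherwise. $\mathbf{1}$ is the vector of all ones in $\mathbb{R}^r$. *)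

theory Defs
  imports "HOL-Analysis.Analysis"
begin

text \<open>The exponent ranges over \<open>[1, \<infinity>]\<close>; values of \<^term>\<open>p\<close> below 1 carry no meaning.\<close>

definition vec_pnorm :: "ereal \<Rightarrow> real ^ 'n \<Rightarrow> real" where
  "vec_pnorm p x =
     (if p = \<infinity> then infnorm x
      else (\<Sum>i\<in>UNIV. \<bar>x $ i\<bar> powr real_of_ereal p) powr (1 / real_of_ereal p))"

definition matrix_pnorm :: "ereal \<Rightarrow> real ^ 'n ^ 'n \<Rightarrow> real" where
  "matrix_pnorm p A = (SUP x\<in>{x. x \<noteq> 0}. vec_pnorm p (A *v x) / vec_pnorm p x)"

definition matrix_measure :: "ereal \<Rightarrow> real ^ 'n ^ 'n \<Rightarrow> real" where
  "matrix_measure p M =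
     Lim (at_right 0) (\<lambda>h::real. (matrix_pnorm p (mat 1 + h *\<^sub>R M) - 1) / h)"

definition metzler_majorant :: "real ^ 'n ^ 'n \<Rightarrow> real ^ 'n ^ 'n" where
  "metzler_majorant G = (\<chi> i k. if i = k then G $ i $ k else \<bar>G $ i $ k\<bar>)"

text \<open>Here \<^term>\<open>1 :: real ^ 'n\<close> is the vector of all ones.\<close>

definition p_lower :: "real ^ 'n ^ 'n \<Rightarrow> real" where
  "p_lower G =
     1 + (MAX i. (transpose (metzler_majorant G) *v 1) $ i / - (metzler_majorant G *v 1) $ i)"

end

theory Submission
  imports Defs
begin

text \<open>
  Write \<open>R\<^sub>i\<close> and \<open>C\<^sub>i\<close> for the row and column sums of the Metzler majorant of \<open>\<Gamma>\<close>.  By convexity of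
  the norm, the quotient \<open>(\<parallel>I + h \<Gamma>\<parallel> - 1) / h\<close> is nondecreasing in \<open>h > 0\<close>, so the matrix measure
  is an infimum, and it is negative exactly when some \<open>I + h \<Gamma>\<close> with \<open>h > 0\<close> is a strict
  contraction (\<open>matrix_measure_neg_iff\<close>).  All later arguments concern such a single \<open>h\<close>.

  Evaluating a contraction at sign vectors and at unit vectors shows that \<open>\<mu>\<^sub>\<infinity>(\<Gamma>) < 0\<close> forces all
  \<open>R\<^sub>i < 0\<close> and \<open>\<mu>\<^sub>1(\<Gamma>) < 0\<close> forces all \<open>C\<^sub>i < 0\<close>.  Conversely, for finite \<open>p\<close>, Jensen's inequality
  gives for any matrix \<open>A\<close> with nonzero rows, with \<open>r\<^sub>i\<close> the sum of the absolute values in row \<open>i\<close>,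
  the bound that the \<open>p\<close>-th power of \<open>\<parallel>A\<parallel>\<^sub>p\<close> is at most the maximum over \<open>k\<close> of
  \<open>\<Sum>\<^sub>i r\<^sub>i powr (p - 1) * \<bar>A\<^sub>i\<^sub>k\<bar>\<close>.  For \<open>A = I + h \<Gamma>\<close> this sum is \<open>1\<close> at \<open>h = 0\<close> and has
  right derivative \<open>(p - 1) R\<^sub>k + C\<^sub>k\<close> there.  Hence \<open>\<mu>\<^sub>p(\<Gamma>) < 0\<close> as soon as
  \<open>(p - 1) R\<^sub>k + C\<^sub>k < 0\<close> for all \<open>k\<close> (\<open>matrix_measure_neg_if_weighted_sum_neg\<close>).

  In case (a) both terms are negative.  In case (b) the condition on \<open>p\<close> says precisely that
  \<open>p - 1\<close> exceeds every ratio \<open>C\<^sub>k / -R\<^sub>k\<close>.  The criterion at \<open>p = 1\<close> shows that \<open>\<mu>\<^sub>1(\<Gamma>) \<ge> 0\<close> leaves some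
  \<open>C\<^sub>k \<ge> 0\<close>, so the largest ratio is nonnegative.
\<close>

section \<open>The vector \<open>p\<close>-norms are norms\<close>

text \<open>The endpoint \<open>0\<close> is needed because vectors may have zero entries; there convexity amounts
  to \<open>s powr p \<le> s\<close> for \<open>0 < s < 1\<close>.\<close>

lemma powr_convex_nonneg:
  assumes "p \<ge> 1"
  shows "convex_on {0..} (\<lambda>x::real. x powr p)"
proof (rule convex_onI)
  fix t x y :: real
  assume t: "0 < t" "t < 1" and xy: "x \<in> {0..}" "y \<in> {0..}"
  have shrink: "(s * z) powr p \<le> s * z powr p" if "0 < s" "s < 1" "0 \<le> z" for s z :: real
  proof -
    have "s powr p \<le> s powr 1"
      using that assms by (intro powr_mono') auto
    then show ?thesis
      using that by (simp add: powr_mult mult_right_mono)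
  qed
  show "((1 - t) *\<^sub>R x + t *\<^sub>R y) powr p \<le> (1 - t) * x powr p + t * y powr p"
  proof (cases "x = 0 \<or> y = 0")
    case True
    then show ?thesis
      using shrink[of t y] shrink[of "1 - t" x] t xy by auto
  next
    case False
    then show ?thesis
      using convex_onD[OF powr_convex[OF assms], of t x y] t xy by simp
  qed
qed simp

lemma vec_pnorm_powr:
  assumes "p \<ge> 1"
  shows "vec_pnorm (ereal p) x powr p = (\<Sum>i\<in>UNIV. \<bar>x $ i\<bar> powr p)"
  using assms by (simp add: vec_pnorm_def powr_powr sum_nonneg)

lemma component_le_vec_pnorm:
  assumes "p \<ge> 1"
  shows "\<bar>x $ i\<bar> \<le> vec_pnorm p x"
proof (cases p)
  case (real q)
  then have q: "q \<ge> 1" using assms by simp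
  have "\<bar>x $ i\<bar> powr q \<le> (\<Sum>i\<in>UNIV. \<bar>x $ i\<bar> powr q)"
    by (rule member_le_sum) auto
  then have "(\<bar>x $ i\<bar> powr q) powr (1 / q) \<le> (\<Sum>i\<in>UNIV. \<bar>x $ i\<bar> powr q) powr (1 / q)"
    using q by (intro powr_mono2) auto
  then show ?thesis
    using q real by (simp add: vec_pnorm_def powr_powr)
next
  case PInf
  then show ?thesis by (simp add: vec_pnorm_def component_le_infnorm_cart)
qed (use assms in auto)

lemma vec_pnorm_nonneg: "p \<ge> 1 \<Longrightarrow> vec_pnorm p x \<ge> 0"
  using component_le_vec_pnorm[of p x undefined] by linarith

lemma vec_pnorm_pos:
  assumes "p \<ge> 1" "x \<noteq> 0"
  shows "vec_pnorm p x > 0"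
proof -
  obtain i where "x $ i \<noteq> 0" using assms(2) by (auto simp: vec_eq_iff)
  then show ?thesis using component_le_vec_pnorm[OF assms(1), of x i] by linarith
qed

lemma vec_pnorm_0 [simp]: "vec_pnorm p 0 = 0"
  by (simp add: vec_pnorm_def infnorm_0)

lemma vec_pnorm_scaleR:
  assumes "p \<ge> 1"
  shows "vec_pnorm p (c *\<^sub>R x) = \<bar>c\<bar> * vec_pnorm p x"
proof (cases p)
  case (real q)
  then show ?thesis
    using assms
    by (simp add: vec_pnorm_def abs_mult powr_mult sum_nonneg powr_powr flip: sum_distrib_left)
next
  case PInf
  then show ?thesis by (simp add: vec_pnorm_def infnorm_mul)
qed (use assms in auto)

text \<open>Minkowski's inequality: after normalising both summands to length one, it says that
  the \<open>p\<close>-th power is convex.\<close>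

lemma vec_pnorm_triangle:
  assumes "p \<ge> 1"
  shows "vec_pnorm p (x + y) \<le> vec_pnorm p x + vec_pnorm p y"
proof (cases p)
  case (real q)
  then have q: "q \<ge> 1" using assms by simp
  show ?thesis
  proof (cases "x = 0 \<or> y = 0")
    case False
    define a where "a = vec_pnorm p x"
    define b where "b = vec_pnorm p y"
    have pos: "a > 0" "b > 0"
      using False vec_pnorm_pos[OF assms] by (auto simp: a_def b_def)
    \<comment> \<open>\<open>(x + y) / (a + b)\<close> is the convex combination, with weights \<open>1 - t\<close> and \<open>t\<close>,
      of the unit vectors \<open>x / a\<close> and \<open>y / b\<close>\<close>
    define t where "t = b / (a + b)"
    have t: "0 \<le> t" "t \<le> 1" "(1 - t) * (a + b) = a" "t * (a + b) = b"
      using pos by (auto simp: t_def field_simps)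
    have norm_a: "(\<Sum>i\<in>UNIV. \<bar>x $ i\<bar> powr q) = a powr q"
      and norm_b: "(\<Sum>i\<in>UNIV. \<bar>y $ i\<bar> powr q) = b powr q"
      using vec_pnorm_powr[OF q, of x] vec_pnorm_powr[OF q, of y] real
      by (simp_all add: a_def b_def)
    have term_le: "\<bar>(x + y) $ i\<bar> powr q
        \<le> (a + b) powr q * ((1 - t) * (\<bar>x $ i\<bar> powr q / a powr q)
                           + t * (\<bar>y $ i\<bar> powr q / b powr q))" for i
    proof -
      have "(a + b) * ((1 - t) * (\<bar>x $ i\<bar> / a) + t * (\<bar>y $ i\<bar> / b))
          = ((1 - t) * (a + b)) * (\<bar>x $ i\<bar> / a) + (t * (a + b)) * (\<bar>y $ i\<bar> / b)"
        by (subst distrib_left) (simp only: mult_ac)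
      also have "\<dots> = \<bar>x $ i\<bar> + \<bar>y $ i\<bar>"
        using pos by (simp add: t)
      finally have "\<bar>(x + y) $ i\<bar> \<le> (a + b) * ((1 - t) * (\<bar>x $ i\<bar> / a) + t * (\<bar>y $ i\<bar> / b))"
        by simp
      then have "\<bar>(x + y) $ i\<bar> powr q
          \<le> ((a + b) * ((1 - t) * (\<bar>x $ i\<bar> / a) + t * (\<bar>y $ i\<bar> / b))) powr q"
        using q by (intro powr_mono2) auto
      also have "\<dots> = (a + b) powr q * ((1 - t) * (\<bar>x $ i\<bar> / a) + t * (\<bar>y $ i\<bar> / b)) powr q"
        using pos t by (subst powr_mult) auto
      also have "\<dots> \<le> (a + b) powr q * ((1 - t) * (\<bar>x $ i\<bar> / a) powr q
                                        + t * (\<bar>y $ i\<bar> / b) powr q)"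
        using convex_onD[OF powr_convex_nonneg[OF q], of t "\<bar>x $ i\<bar> / a" "\<bar>y $ i\<bar> / b"] pos t
        by (intro mult_left_mono) auto
      finally show ?thesis
        using pos by (simp add: powr_divide)
    qed
    have "vec_pnorm p (x + y) powr q = (\<Sum>i\<in>UNIV. \<bar>(x + y) $ i\<bar> powr q)"
      using vec_pnorm_powr[OF q, of "x + y"] real by simp
    also have "\<dots> \<le> (\<Sum>i\<in>UNIV. (a + b) powr q * ((1 - t) * (\<bar>x $ i\<bar> powr q / a powr q)
                           + t * (\<bar>y $ i\<bar> powr q / b powr q)))"
      by (rule sum_mono) (rule term_le)
    also have "\<dots> = (a + b) powr q * ((1 - t) * ((\<Sum>i\<in>UNIV. \<bar>x $ i\<bar> powr q) / a powr q)
                           + t * ((\<Sum>i\<in>UNIV. \<bar>y $ i\<bar> powr q) / b powr q))"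
      by (simp only: sum_distrib_left sum.distrib sum_divide_distrib distrib_left)
    also have "\<dots> = (a + b) powr q"
      using pos by (simp add: norm_a norm_b)
    finally have "vec_pnorm p (x + y) \<le> a + b"
      using powr_less_mono2[of q "a + b" "vec_pnorm p (x + y)"] q pos
      by (meson add_nonneg_nonneg less_eq_real_def not_less zero_less_one order_less_le_trans)
    then show ?thesis by (simp add: a_def b_def)
  qed auto
next
  case PInf
  then show ?thesis by (simp add: vec_pnorm_def infnorm_triangle)
qed (use assms in auto)

lemma vec_pnorm_sum:
  assumes "p \<ge> 1"
  shows "vec_pnorm p (\<Sum>i\<in>I. f i) \<le> (\<Sum>i\<in>I. vec_pnorm p (f i))"
proof (induction I rule: infinite_finite_induct)
  case (insert i I)
  then show ?case
    using vec_pnorm_triangle[OF assms, of "f i" "sum f I"] by simp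
qed auto

section \<open>The induced matrix norm\<close>

text \<open>The supremum defining the induced norm is a real-valued one, so boundedness must be
  known before it can serve as an upper bound.  The sum of the norms of the columns is a
  sufficient constant since each entry of \<open>x\<close> is at most the norm of \<open>x\<close>.\<close>

lemma matrix_pnorm_bdd_above:
  fixes A :: "real ^ 'n ^ 'n"
  assumes "p \<ge> 1"
  shows "bdd_above ((\<lambda>x. vec_pnorm p (A *v x) / vec_pnorm p x) ` {x. x \<noteq> 0})"
proof (rule bdd_aboveI2)
  fix x :: "real ^ 'n"
  assume "x \<in> {x. x \<noteq> 0}"
  then have pos: "vec_pnorm p x > 0" using vec_pnorm_pos[OF assms] by simp
  have "vec_pnorm p (A *v x) = vec_pnorm p (\<Sum>k\<in>UNIV. (x $ k) *\<^sub>R column k A)"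
    by (simp add: matrix_mult_sum scalar_mult_eq_scaleR)
  also have "\<dots> \<le> (\<Sum>k\<in>UNIV. \<bar>x $ k\<bar> * vec_pnorm p (column k A))"
    using vec_pnorm_sum[OF assms] by (simp flip: vec_pnorm_scaleR[OF assms])
  also have "\<dots> \<le> (\<Sum>k\<in>UNIV. vec_pnorm p x * vec_pnorm p (column k A))"
    by (intro sum_mono mult_right_mono component_le_vec_pnorm vec_pnorm_nonneg assms)
  also have "\<dots> = vec_pnorm p x * (\<Sum>k\<in>UNIV. vec_pnorm p (column k A))"
    by (simp add: sum_distrib_left)
  finally show "vec_pnorm p (A *v x) / vec_pnorm p x \<le> (\<Sum>k\<in>UNIV. vec_pnorm p (column k A))"
    using pos by (simp add: field_simps)
qed

lemma vec_pnorm_mult_le: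
  fixes A :: "real ^ 'n ^ 'n"
  assumes "p \<ge> 1"
  shows "vec_pnorm p (A *v x) \<le> matrix_pnorm p A * vec_pnorm p x"
proof (cases "x = 0")
  case False
  then have "vec_pnorm p (A *v x) / vec_pnorm p x \<le> matrix_pnorm p A"
    unfolding matrix_pnorm_def
    by (intro cSUP_upper matrix_pnorm_bdd_above assms) auto
  then show ?thesis
    using vec_pnorm_pos[OF assms False] by (simp add: field_simps)
qed auto

lemma matrix_pnorm_leI:
  fixes A :: "real ^ 'n ^ 'n"
  assumes "p \<ge> 1"
    and "\<And>x. vec_pnorm p (A *v x) \<le> c * vec_pnorm p x"
  shows "matrix_pnorm p A \<le> c"
  unfolding matrix_pnorm_def
proof (rule cSUP_least)
  show "{x :: real ^ 'n. x \<noteq> 0} \<noteq> {}"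
    by (auto intro: exI[of _ 1])
next
  fix x :: "real ^ 'n"
  assume "x \<in> {x. x \<noteq> 0}"
  then show "vec_pnorm p (A *v x) / vec_pnorm p x \<le> c"
    using vec_pnorm_pos[OF assms(1), of x] assms(2)[of x] by (simp add: field_simps)
qed

text \<open>Since \<open>I + t M = (1 - t) I + t (I + M)\<close>, this is convexity of the norm together with
  \<open>\<parallel>I\<parallel> \<le> 1\<close>; the form chosen says that the difference quotient defining the matrix measure is
  monotone.\<close>

lemma matrix_pnorm_convex_mat_1:
  fixes M :: "real ^ 'n ^ 'n"
  assumes "p \<ge> 1" "0 \<le> t" "t \<le> 1"
  shows "matrix_pnorm p (mat 1 + t *\<^sub>R M) - 1 \<le> t * (matrix_pnorm p (mat 1 + M) - 1)"
proof -
  let ?c = "matrix_pnorm p (mat 1 + M)"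
  have "matrix_pnorm p (mat 1 + t *\<^sub>R M) \<le> (1 - t) + t * ?c"
  proof (rule matrix_pnorm_leI[OF assms(1)])
    fix x
    have "(mat 1 + t *\<^sub>R M) *v x = (1 - t) *\<^sub>R x + t *\<^sub>R ((mat 1 + M) *v x)"
      by (simp add: matrix_vector_mult_add_rdistrib algebra_simps flip: scaleR_matrix_vector_assoc)
    then have "vec_pnorm p ((mat 1 + t *\<^sub>R M) *v x)
        \<le> (1 - t) * vec_pnorm p x + t * vec_pnorm p ((mat 1 + M) *v x)"
      using vec_pnorm_triangle[OF assms(1), of "(1 - t) *\<^sub>R x" "t *\<^sub>R ((mat 1 + M) *v x)"]
        assms by (simp add: vec_pnorm_scaleR)
    also have "\<dots> \<le> (1 - t) * vec_pnorm p x + t * (?c * vec_pnorm p x)"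
      by (intro add_left_mono mult_left_mono vec_pnorm_mult_le assms)
    finally show "vec_pnorm p ((mat 1 + t *\<^sub>R M) *v x) \<le> ((1 - t) + t * ?c) * vec_pnorm p x"
      by (simp add: algebra_simps)
  qed
  then show ?thesis by (simp add: algebra_simps)
qed

section \<open>The sign of the matrix measure\<close>

text \<open>The difference quotient is nondecreasing in the step \<open>h\<close> and bounded below, so its limit at
  \<open>0\<close> exists and equals its infimum; an infimum is negative iff some value is.\<close>

lemma matrix_measure_neg_iff:
  fixes M :: "real ^ 'n ^ 'n"
  assumes "p \<ge> 1"
  shows "matrix_measure p M < 0 \<longleftrightarrow> (\<exists>h>0. matrix_pnorm p (mat 1 + h *\<^sub>R M) < 1)"
proof -
  define q where "q = (\<lambda>h. (matrix_pnorm p (mat 1 + h *\<^sub>R M) - 1) / h)"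
  define L where "L = (INF h\<in>{0<..}. q h)"
  have mono: "q g \<le> q h" if "0 < g" "g \<le> h" for g h
    using matrix_pnorm_convex_mat_1[OF assms, of "g / h" "h *\<^sub>R M"] that
    by (simp add: q_def field_simps)
  have bdd: "bdd_below (q ` {0<..})"
  proof (rule bdd_belowI2)
    fix h :: real
    assume "h \<in> {0<..}"
    then have h: "h > 0" by simp
    have pos: "vec_pnorm p (1 :: real ^ 'n) > 0"
      by (rule vec_pnorm_pos[OF assms]) simp
    let ?A = "mat 1 + h *\<^sub>R M"
    \<comment> \<open>the reverse triangle inequality at one nonzero vector bounds \<open>\<parallel>I + h M\<parallel>\<close> from below\<close>
    have "1 = ?A *v 1 + (- h) *\<^sub>R (M *v 1)"
      by (simp add: matrix_vector_mult_add_rdistrib flip: scaleR_matrix_vector_assoc)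
    then have "vec_pnorm p (1 :: real ^ 'n)
        \<le> vec_pnorm p (?A *v 1) + vec_pnorm p ((- h) *\<^sub>R (M *v 1))"
      using vec_pnorm_triangle[OF assms, of "?A *v 1" "(- h) *\<^sub>R (M *v 1)"] by simp
    also have "\<dots> \<le> matrix_pnorm p ?A * vec_pnorm p (1 :: real ^ 'n) + h * vec_pnorm p (M *v 1)"
      using vec_pnorm_mult_le[OF assms, of ?A 1] h by (simp only: vec_pnorm_scaleR[OF assms])
    finally show "- (vec_pnorm p (M *v 1) / vec_pnorm p (1 :: real ^ 'n)) \<le> q h"
      using pos h by (simp add: q_def field_simps)
  qed
  have "(q \<longlongrightarrow> L) (at_right 0)"
  proof (rule order_tendstoI)
    fix a assume "a < L"
    moreover have "L \<le> q h" if "h > 0" for h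
      unfolding L_def using bdd that by (intro cINF_lower) auto
    ultimately show "\<forall>\<^sub>F h in at_right 0. a < q h"
      by (force simp: eventually_at_right_field intro: exI[of _ 1])
  next
    fix a assume "L < a"
    then obtain h where "h > 0" "q h < a"
      unfolding L_def using bdd by (subst (asm) cINF_less_iff) auto
    then show "\<forall>\<^sub>F g in at_right 0. q g < a"
      using mono unfolding eventually_at_right_field
      by (meson less_eq_real_def order_le_less_trans)
  qed
  then have "matrix_measure p M = L"
    unfolding matrix_measure_def q_def by (intro tendsto_Lim) auto
  then have "matrix_measure p M < 0 \<longleftrightarrow> (\<exists>h>0. q h < 0)"
    unfolding L_def using bdd by (simp add: cINF_less_iff) auto
  also have "\<dots> \<longleftrightarrow> (\<exists>h>0. matrix_pnorm p (mat 1 + h *\<^sub>R M) < 1)"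
    by (auto simp: q_def divide_less_0_iff)
  finally show ?thesis .
qed

section \<open>Row and column sums of the Metzler majorant\<close>

lemma metzler_majorant_row_sum:
  "(metzler_majorant G *v 1) $ i = (\<Sum>k\<in>UNIV. metzler_majorant G $ i $ k)"
  by (simp add: matrix_vector_mult_def)

lemma metzler_majorant_column_sum:
  "(transpose (metzler_majorant G) *v 1) $ k = (\<Sum>i\<in>UNIV. metzler_majorant G $ i $ k)"
  by (simp add: matrix_vector_mult_def transpose_def)

text \<open>Row \<open>i\<close> of \<open>I + h G\<close> is tested on the vector that carries the signs of the off-diagonal
  entries of that row, which turns the entry \<open>i\<close> of the image into \<open>1 + h R\<^sub>i\<close>; a strict
  contraction makes it less than \<open>1\<close>.\<close>

lemma row_sum_neg_if_matrix_measure_inf_neg: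
  fixes G :: "real ^ 'n ^ 'n"
  assumes "matrix_measure \<infinity> G < 0"
  shows "(metzler_majorant G *v 1) $ i < 0"
proof -
  obtain h where h: "h > 0" and lt1: "matrix_pnorm \<infinity> (mat 1 + h *\<^sub>R G) < 1"
    using assms by (auto simp: matrix_measure_neg_iff)
  define x :: "real ^ 'n" where "x = (\<chi> k. if k = i then 1 else sgn (G $ i $ k))"
  have x1: "vec_pnorm \<infinity> x \<le> 1"
    unfolding vec_pnorm_def infnorm_cart
    by (auto simp: x_def abs_sgn_eq intro!: cSup_least)
  have "x $ i = 1" by (simp add: x_def)
  then have "x \<noteq> 0" by force
  then have x0: "vec_pnorm \<infinity> x > 0" by (intro vec_pnorm_pos) auto
  have "(G *v x) $ i = (metzler_majorant G *v 1) $ i"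
    by (auto simp: matrix_vector_mult_def metzler_majorant_def x_def abs_sgn intro!: sum.cong)
  then have "1 + h * (metzler_majorant G *v 1) $ i = ((mat 1 + h *\<^sub>R G) *v x) $ i"
    using \<open>x $ i = 1\<close>
    by (simp add: matrix_vector_mult_add_rdistrib flip: scaleR_matrix_vector_assoc)
  also have "\<dots> \<le> vec_pnorm \<infinity> ((mat 1 + h *\<^sub>R G) *v x)"
    using component_le_vec_pnorm[of \<infinity> "(mat 1 + h *\<^sub>R G) *v x" i] by simp
  also have "\<dots> \<le> matrix_pnorm \<infinity> (mat 1 + h *\<^sub>R G) * vec_pnorm \<infinity> x"
    by (rule vec_pnorm_mult_le) simp
  also have "\<dots> < 1 * vec_pnorm \<infinity> x"
    using lt1 x0 by (rule mult_strict_right_mono)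
  also have "\<dots> \<le> 1"
    using x1 by simp
  finally show ?thesis
    using h by (simp add: mult_less_0_iff)
qed

text \<open>The \<open>1\<close>-norm of column \<open>k\<close> of \<open>I + h G\<close>, the image of a unit vector, is at least
  \<open>1 + h C\<^sub>k\<close>.\<close>

lemma column_sum_neg_if_matrix_measure_1_neg:
  fixes G :: "real ^ 'n ^ 'n"
  assumes "matrix_measure 1 G < 0"
  shows "(transpose (metzler_majorant G) *v 1) $ k < 0"
proof -
  obtain h where h: "h > 0" and lt1: "matrix_pnorm 1 (mat 1 + h *\<^sub>R G) < 1"
    using assms by (auto simp: matrix_measure_neg_iff)
  let ?A = "mat 1 + h *\<^sub>R G"
  have norm1: "vec_pnorm 1 x = (\<Sum>i\<in>UNIV. \<bar>x $ i\<bar>)" for x :: "real ^ 'n"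
    by (simp add: vec_pnorm_def sum_nonneg)
  have "(\<Sum>i\<in>UNIV. mat 1 $ i $ k + h * metzler_majorant G $ i $ k) \<le> (\<Sum>i\<in>UNIV. \<bar>?A $ i $ k\<bar>)"
    using h by (intro sum_mono) (auto simp: mat_def metzler_majorant_def abs_mult)
  then have "1 + h * (transpose (metzler_majorant G) *v 1) $ k \<le> (\<Sum>i\<in>UNIV. \<bar>?A $ i $ k\<bar>)"
    unfolding metzler_majorant_column_sum by (simp add: sum.distrib sum_distrib_left mat_def)
  also have "\<dots> = vec_pnorm 1 (?A *v axis k 1)"
    by (simp add: norm1 matrix_vector_mul_component inner_axis)
  also have "\<dots> \<le> matrix_pnorm 1 ?A * vec_pnorm 1 (axis k 1)"
    by (rule vec_pnorm_mult_le) simp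
  also have "vec_pnorm 1 (axis k 1 :: real ^ 'n) = 1"
    by (simp add: norm1 axis_def if_distrib cong: if_cong)
  finally show ?thesis
    using h lt1 by (smt (verit) mult_nonneg_nonneg)
qed

section \<open>A weighted bound on the induced norm\<close>

text \<open>Jensen's inequality for the \<open>p\<close>-th power with weights \<open>\<bar>a k\<bar>\<close> divided by their sum.\<close>

lemma abs_sum_mult_powr_le:
  fixes a x :: "'a \<Rightarrow> real"
  assumes "p \<ge> 1" "finite I" "(\<Sum>k\<in>I. \<bar>a k\<bar>) > 0"
  shows "\<bar>\<Sum>k\<in>I. a k * x k\<bar> powr p
      \<le> (\<Sum>k\<in>I. \<bar>a k\<bar>) powr (p - 1) * (\<Sum>k\<in>I. \<bar>a k\<bar> * \<bar>x k\<bar> powr p)"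
proof -
  define r where "r = (\<Sum>k\<in>I. \<bar>a k\<bar>)"
  have r: "r > 0" using assms by (simp add: r_def)
  have ne: "I \<noteq> {}" using assms(3) by auto
  have "\<bar>\<Sum>k\<in>I. a k * x k\<bar> \<le> (\<Sum>k\<in>I. \<bar>a k\<bar> * \<bar>x k\<bar>)"
    by (rule order_trans[OF sum_abs]) (simp add: abs_mult)
  also have "\<dots> = r * (\<Sum>k\<in>I. \<bar>a k\<bar> / r * \<bar>x k\<bar>)"
    using r by (simp add: sum_distrib_left)
  finally have "\<bar>\<Sum>k\<in>I. a k * x k\<bar> powr p \<le> (r * (\<Sum>k\<in>I. \<bar>a k\<bar> / r * \<bar>x k\<bar>)) powr p"
    using assms(1) by (intro powr_mono2) auto
  also have "\<dots> = r powr p * (\<Sum>k\<in>I. \<bar>a k\<bar> / r * \<bar>x k\<bar>) powr p"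
    using r by (subst powr_mult) (auto intro!: sum_nonneg)
  also have "(\<Sum>k\<in>I. \<bar>a k\<bar> / r * \<bar>x k\<bar>) powr p \<le> (\<Sum>k\<in>I. \<bar>a k\<bar> / r * \<bar>x k\<bar> powr p)"
    using convex_on_sum[OF assms(2) ne powr_convex_nonneg[OF assms(1)],
        of "\<lambda>k. \<bar>a k\<bar> / r" "\<lambda>k. \<bar>x k\<bar>"] r
    by (simp add: r_def flip: sum_divide_distrib)
  also have "r powr p * (\<Sum>k\<in>I. \<bar>a k\<bar> / r * \<bar>x k\<bar> powr p)
      = r powr (p - 1) * (\<Sum>k\<in>I. \<bar>a k\<bar> * \<bar>x k\<bar> powr p)"
    using r by (simp add: powr_diff sum_distrib_left flip: sum_divide_distrib)
  finally show ?thesis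
    using r by (simp add: r_def)
qed

text \<open>Applying the preceding inequality to each row and exchanging the sums bounds the \<open>p\<close>-th
  power of the norm of \<open>A x\<close> by a weighted sum of the \<open>\<bar>x\<^sub>k\<bar> powr p\<close>, whose weights are the sums
  in the last assumption.  Keeping a separate row factor for each \<open>i\<close>, instead of the largest
  one, is what makes the bound sharp to first order at the identity matrix.\<close>

lemma matrix_pnorm_less_1I:
  fixes A :: "real ^ 'n ^ 'n"
  assumes "p \<ge> 1"
    and rows: "\<And>i. (\<Sum>k\<in>UNIV. \<bar>A $ i $ k\<bar>) > 0"
    and cols: "\<And>k. (\<Sum>i\<in>UNIV. (\<Sum>l\<in>UNIV. \<bar>A $ i $ l\<bar>) powr (p - 1) * \<bar>A $ i $ k\<bar>) < 1"
  shows "matrix_pnorm (ereal p) A < 1"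
proof -
  define s where
    "s k = (\<Sum>i\<in>UNIV. (\<Sum>l\<in>UNIV. \<bar>A $ i $ l\<bar>) powr (p - 1) * \<bar>A $ i $ k\<bar>)" for k
  define c where "c = Max (range s)"
  have s0: "s k \<ge> 0" for k
    by (auto simp: s_def intro!: sum_nonneg)
  have sc: "s k \<le> c" for k
    by (simp add: c_def)
  have c1: "c < 1"
    using cols by (simp add: c_def s_def)
  have c0: "c \<ge> 0"
    using s0 sc order_trans by blast
  have "matrix_pnorm (ereal p) A \<le> c powr (1 / p)"
  proof (rule matrix_pnorm_leI)
    fix x
    have "(\<Sum>i\<in>UNIV. \<bar>(A *v x) $ i\<bar> powr p)
        \<le> (\<Sum>i\<in>UNIV. (\<Sum>l\<in>UNIV. \<bar>A $ i $ l\<bar>) powr (p - 1)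
                      * (\<Sum>k\<in>UNIV. \<bar>A $ i $ k\<bar> * \<bar>x $ k\<bar> powr p))"
      unfolding matrix_vector_mult_def
      using abs_sum_mult_powr_le[OF assms(1) finite rows] by (auto intro!: sum_mono)
    also have "\<dots> = (\<Sum>k\<in>UNIV. s k * \<bar>x $ k\<bar> powr p)"
      unfolding s_def sum_distrib_left sum_distrib_right
      by (subst sum.swap) (simp add: mult_ac)
    also have "\<dots> \<le> (\<Sum>k\<in>UNIV. c * \<bar>x $ k\<bar> powr p)"
      by (intro sum_mono mult_right_mono sc) auto
    also have "\<dots> = c * (\<Sum>k\<in>UNIV. \<bar>x $ k\<bar> powr p)"
      by (simp add: sum_distrib_left)
    finally have "(\<Sum>i\<in>UNIV. \<bar>(A *v x) $ i\<bar> powr p) powr (1 / p)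
        \<le> (c * (\<Sum>k\<in>UNIV. \<bar>x $ k\<bar> powr p)) powr (1 / p)"
      using assms(1) by (intro powr_mono2) (auto intro!: sum_nonneg)
    also have "\<dots> = c powr (1 / p) * (\<Sum>k\<in>UNIV. \<bar>x $ k\<bar> powr p) powr (1 / p)"
      by (rule powr_mult)
    finally show "vec_pnorm (ereal p) (A *v x) \<le> c powr (1 / p) * vec_pnorm (ereal p) x"
      by (simp add: vec_pnorm_def)
  qed (use assms in auto)
  also have "\<dots> < 1"
    using powr_less_mono2[of "1 / p" c 1] assms(1) c0 c1 by simp
  finally show ?thesis .
qed

text \<open>The weights of \<open>matrix_pnorm_less_1I\<close> for \<open>I + h G\<close> all start at \<open>1\<close> and initially decrease
  at the rates in the assumption.\<close>

lemma matrix_measure_neg_if_weighted_sum_neg: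
  fixes G :: "real ^ 'n ^ 'n"
  assumes p: "p \<ge> 1"
    and neg: "\<And>k. (p - 1) * (metzler_majorant G *v 1) $ k
                   + (transpose (metzler_majorant G) *v 1) $ k < 0"
  shows "matrix_measure (ereal p) G < 0"
proof -
  define M where "M = metzler_majorant G"
  define R where "R i = (\<Sum>k\<in>UNIV. M $ i $ k)" for i
  define C where "C k = (\<Sum>i\<in>UNIV. M $ i $ k)" for k
  \<comment> \<open>\<open>B h i k\<close> is the absolute value of the entry of \<open>I + h G\<close>, but only while \<open>h \<ge> 0\<close> is small enough
    to keep the diagonal nonnegative; as an affine function of \<open>h\<close> it is differentiable at \<open>0\<close>\<close>
  define B where "B h i k = mat 1 $ i $ k + h * M $ i $ k" for h i k
  define f where "f k h = (\<Sum>i\<in>UNIV. (1 + h * R i) powr (p - 1) * B h i k)" for k h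
  have RC: "(p - 1) * R k + C k < 0" for k
    using neg[of k] unfolding metzler_majorant_row_sum metzler_majorant_column_sum
    by (simp add: R_def C_def M_def)
  have ev_f: "\<forall>\<^sub>F h in at_right 0. f k h < 1" for k
  proof -
    have "(f k has_real_derivative
        (\<Sum>i\<in>UNIV. (p - 1) * R i * mat 1 $ i $ k + M $ i $ k)) (at 0)"
      unfolding f_def B_def by (auto intro!: derivative_eq_intros)
    moreover have "(\<Sum>i\<in>UNIV. (p - 1) * R i * mat 1 $ i $ k + M $ i $ k) = (p - 1) * R k + C k"
      unfolding C_def sum.distrib by (simp add: mat_def if_distrib cong: if_cong)
    ultimately obtain d where "d > 0" "\<And>h. 0 < h \<Longrightarrow> h < d \<Longrightarrow> f k (0 + h) < f k 0"
      using RC[of k] DERIV_neg_dec_right[of "f k" _ 0] by metis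
    moreover have "f k 0 = 1"
      by (simp add: f_def B_def mat_def)
    ultimately show ?thesis
      by (auto simp: eventually_at_right_field)
  qed
  have ev_pos: "\<forall>\<^sub>F h in at_right 0. 0 < 1 + h * c" for c :: real
  proof -
    have "((\<lambda>h. 1 + h * c) \<longlongrightarrow> 1 + 0 * c) (at_right 0)"
      by (intro tendsto_intros)
    then show ?thesis
      by (rule order_tendstoD) simp
  qed
  have "\<forall>\<^sub>F h in at_right (0::real). h > 0 \<and> (\<forall>k. f k h < 1) \<and> (\<forall>i. 0 < 1 + h * R i)
      \<and> (\<forall>i. 0 < 1 + h * G $ i $ i)"
    by (intro eventually_conj eventually_all_finite ev_f ev_pos eventually_at_right_less)
  then have "\<exists>h>0. (\<forall>k. f k h < 1) \<and> (\<forall>i. 0 < 1 + h * R i) \<and> (\<forall>i. 0 < 1 + h * G $ i $ i)"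
    by (rule eventually_happens'[OF trivial_limit_at_right_real])
  then obtain h where h: "h > 0" and f: "\<And>k. f k h < 1" and R: "\<And>i. 0 < 1 + h * R i"
    and G: "\<And>i. 0 < 1 + h * G $ i $ i"
    by blast
  have abs_eq: "\<bar>(mat 1 + h *\<^sub>R G) $ i $ k\<bar> = B h i k" for i k
    using h G[of i] by (auto simp: B_def M_def mat_def metzler_majorant_def abs_mult)
  have row_eq: "(\<Sum>k\<in>UNIV. B h i k) = 1 + h * R i" for i
    by (simp add: B_def R_def sum.distrib mat_def sum_distrib_left)
  have "matrix_pnorm (ereal p) (mat 1 + h *\<^sub>R G) < 1"
    by (rule matrix_pnorm_less_1I[OF p]) (use R f in \<open>simp_all only: abs_eq row_eq f_def\<close>)
  then show ?thesis
    using h p by (auto simp: matrix_measure_neg_iff)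
qed

section \<open>Interpolating between \<open>\<mu>\<^sub>1\<close> and \<open>\<mu>\<^sub>\<infinity>\<close>\<close>

theorem mainTheorem5:
  fixes \<Gamma> :: "real ^ 'r ^ 'r"
  assumes "matrix_measure \<infinity> \<Gamma> < 0"
  shows "(matrix_measure 1 \<Gamma> < 0 \<longrightarrow>
            (\<forall>p::real. 1 < p \<longrightarrow> matrix_measure (ereal p) \<Gamma> < 0)) \<and>
         (matrix_measure 1 \<Gamma> \<ge> 0 \<longrightarrow>
            p_lower \<Gamma> \<ge> 1 \<and>
            (\<forall>p::real. p_lower \<Gamma> < p \<longrightarrow> matrix_measure (ereal p) \<Gamma> < 0))"
proof -
  define R where "R i = (metzler_majorant \<Gamma> *v 1) $ i" for i
  define C where "C i = (transpose (metzler_majorant \<Gamma>) *v 1) $ i" for i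
  have R: "R i < 0" for i
    unfolding R_def by (rule row_sum_neg_if_matrix_measure_inf_neg[OF assms])
  have measure_neg: "matrix_measure (ereal p) \<Gamma> < 0"
    if "p \<ge> 1" "\<And>k. (p - 1) * R k + C k < 0" for p
    using matrix_measure_neg_if_weighted_sum_neg[of p \<Gamma>] that by (simp add: R_def C_def)
  have ratio_le: "1 + C i / - R i \<le> p_lower \<Gamma>" for i
    unfolding p_lower_def R_def C_def by (intro add_left_mono Max_ge) auto
  have "matrix_measure (ereal p) \<Gamma> < 0" if "matrix_measure 1 \<Gamma> < 0" "1 < p" for p
  proof (rule measure_neg)
    fix k
    have "C k < 0"
      unfolding C_def by (rule column_sum_neg_if_matrix_measure_1_neg) fact
    then show "(p - 1) * R k + C k < 0"
      using that R[of k] by (intro add_neg_neg mult_pos_neg) auto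
  qed (use that in simp)
  moreover have lower: "p_lower \<Gamma> \<ge> 1" if nonneg: "matrix_measure 1 \<Gamma> \<ge> 0"
  proof -
    have "\<exists>k. C k \<ge> 0"
    proof (rule ccontr)
      assume "\<not> (\<exists>k. C k \<ge> 0)"
      then have "matrix_measure (ereal 1) \<Gamma> < 0"
        by (intro measure_neg) (auto simp: not_le)
      with nonneg show False by (simp flip: one_ereal_def)
    qed
    then obtain k where "C k \<ge> 0" ..
    then have "C k / - R k \<ge> 0"
      using R[of k] by (intro divide_nonneg_pos) auto
    then show ?thesis
      using ratio_le[of k] by linarith
  qed
  moreover have "matrix_measure (ereal p) \<Gamma> < 0"
    if "matrix_measure 1 \<Gamma> \<ge> 0" "p_lower \<Gamma> < p" for p
  proof (rule measure_neg)
    fix k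
    have "C k / - R k < p - 1"
      using ratio_le[of k] that by linarith
    then show "(p - 1) * R k + C k < 0"
      using R[of k] by (simp add: field_simps)
  qed (use lower that in force)
  ultimately show ?thesis
    by blast
qed

end
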